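(* Let $F:\mathbb{R}^n\times\mathbb{R}^m\to\mathbb{R}$ be $\mathcal C^2$ with $\operatorname{Saddle}(F)\neq\emptyset$, and let the map $(x,z)\mapsto\nabla_{xz}F(x,z)$ be locally Lipschitz. Assume that $F$ is locally jointly strongly quasiconvex-quasiconcave on $\operatorname{Saddle}(F)$. Then each isolated path connected component of $\operatorname{Saddle}(F)$ is locally asymptotically stable under the saddle-point dynamics $X_{\text{sp}}$ of $F$ and, moreover, the convergence of trajectories is to a point. Further, if $F$ is globally jointly strongly quasiconvex-quasiconcave and $\nabla_{xz}F$ is constant over $\mathbb{R}^n\times\mathbb{R}^m$, then $\operatorname{Saddle}(F)$ is globally asymptotically stable under $X_{\text{sp}}$ and the convergence of trajectories is to a point.
   Context: Saddle-point dynamics: for a continuously differentiable $F:\mathbb{R}^n\times\mathbb{R}^m\to\mathbb{R}$ it is $\dot x=-\nabla_xF(x,z)$, $\dot z=\nabla_zF(x,z)$, with vector field denoted $X_{\text{sp}}$. Trajectories are solutions on $t\ge 0$. $\nabla_{xz}F=\frac{\partial^2F}{\partial x\partial z}$ is the matrix of mixed second partial derivatives. Saddle points: $(x_*,z_* )$ is a (local min-max) saddle point of $F$ if there are open neighborhoods $\mathcal U_{x_*}\subset\mathbb{R}^n$ of $x_*$ and $\mathcal U_{z_*}\subset\mathbb{R}^m$ of $z_*$ with $F(x_*,z)\le F(x_*,z_* )\le F(x,z_* )$ for all $z\in\mathcal U_{z_*}$, $x\in\mathcal U_{x_*}$. $\operatorname{Saddle}(F)$ is the set of all such points; it is assumed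 nonempty. Strong quasiconvexity: $f:\mathbb{R}^n\to\mathbb{R}$ is strongly quasiconvex with parameter $s>0$ over a convex set $\mathcal D\subset\mathbb{R}^n$ if $\max\{f(x),f(y)\}-f(\lambda x+(1-\lambda)y)\ge s\lambda(1-\lambda)\|x-y\|^2$ for all $x,y\in\mathcal D$ and $\lambda\in[0,1]$; it is strongly quasiconcave with parameter $s$ over $\mathcal D$ if $-f$ is strongly quasiconvex with parameter $s$ over $\mathcal D$. $F$ is locally jointly strongly quasiconvex-quasiconcave at $(\tilde x,\tilde z)$ if there exist $s>0$ and an open neighborhood $\mathcal U$ of $(\tilde x,\tilde z)$ such that for all $(\bar x,\bar z)\in\mathcal U$ the function $x\mapsto F(x,\bar z)$ is strongly quasiconvex with parameter $s$ over $\mathcal U\cap(\mathbb{R}^n\times\{\bar z\})$ and $z\mapsto F(\bar x,z)$ is strongly quasiconcave with parameter $s$ over $\mathcal U\cap(\{\bar x\}\times\mathbb{R}^m)$. It is so on a set if it is so at each point of the set; it is globally so if one can take $\mathcal U=\mathbb{R}^n\times\mathbb{R}^m$ in this definition. Isolated path connected component: $\mathcal S_c\subset\mathcal S\subset\mathbb{R}^k$ is an isolated path connected component of $\mathcal S$ if $\mathcal S_c$ is path connected and there is an open neighborhood $\mathcal U$ of $\mathcal S_c$ in $\mathbb{R}^k$ with $\mathcal U\cap\mathcal S=\mathcal S_c$. Stability: a set $\mathcal S$ of equilibria is locally asymptotically stable if (a) for every $\epsilon>0$ there is an open set $W\supset\mathcal S$ such that every trajectory starting in $W$ stays within distance less than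 $\epsilon$ of $\mathcal S$ for all $t\ge0$, and (b) there is an open set $W\supset\mathcal S$ such that the distance to $\mathcal S$ of every trajectory starting in $W$ tends to $0$ as $t\to\infty$; globally asymptotically stable if (a) holds and (b) holds with $W$ the whole space. "Convergence is to a point" means that the trajectories starting in some open set containing $\mathcal S$ (all trajectories, in the global case) each converge to a single point of $\mathcal S$. *)

theory Defs
  imports "HOL-Analysis.Analysis"
begin

section \<open>Regularity\<close>

definition C1_fun :: "('a::real_normed_vector \<Rightarrow> 'b::real_normed_vector) \<Rightarrow> bool" where
  "C1_fun f \<longleftrightarrow>
    (\<exists>f'. (\<forall>x. (f has_derivative blinfun_apply (f' x)) (at x)) \<and> continuous_on UNIV f')"

definition C2_fun :: "('a::real_normed_vector \<Rightarrow> 'b::real_normed_vector) \<Rightarrow> bool" where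
  "C2_fun f \<longleftrightarrow>
    (\<exists>f'. (\<forall>x. (f has_derivative blinfun_apply (f' x)) (at x)) \<and> C1_fun f')"

definition locally_lipschitz :: "('a::metric_space \<Rightarrow> 'b::metric_space) \<Rightarrow> bool" where
  "locally_lipschitz f \<longleftrightarrow> (\<forall>p. \<exists>r>0. \<exists>L. L-lipschitz_on (ball p r) f)"


section \<open>Gradients and the saddle-point dynamics\<close>

text \<open>Meaningful only where \<open>f\<close> is differentiable.\<close>

definition grad :: "('a::real_inner \<Rightarrow> real) \<Rightarrow> 'a \<Rightarrow> 'a" where
  "grad f x = (THE D. GDERIV f x :> D)"

definition grad_x :: "((real^'n) \<times> (real^'m) \<Rightarrow> real) \<Rightarrow> (real^'n) \<times> (real^'m) \<Rightarrow> real^'n" where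
  "grad_x F p = grad (\<lambda>x. F (x, snd p)) (fst p)"

definition grad_z :: "((real^'n) \<times> (real^'m) \<Rightarrow> real) \<Rightarrow> (real^'n) \<times> (real^'m) \<Rightarrow> real^'m" where
  "grad_z F p = grad (\<lambda>z. F (fst p, z)) (snd p)"

text \<open>The matrix of mixed second partial derivatives: the entry in row \<open>i\<close> and column \<open>j\<close> is
  the derivative of \<open>\<partial>F/\<partial>x\<^sub>i\<close> in the direction \<open>z\<^sub>j\<close>.\<close>

definition grad_xz ::
  "((real^'n) \<times> (real^'m) \<Rightarrow> real) \<Rightarrow> (real^'n) \<times> (real^'m) \<Rightarrow> real^'m^'n" where
  "grad_xz F p = jacobian (\<lambda>z. grad_x F (fst p, z)) (at (snd p))"

definition X_sp ::
  "((real^'n) \<times> (real^'m) \<Rightarrow> real) \<Rightarrow> (real^'n) \<times> (real^'m) \<Rightarrow> (real^'n) \<times> (real^'m)" where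
  "X_sp F p = (- grad_x F p, grad_z F p)"


section \<open>Saddle points\<close>

definition is_saddle_point :: "((real^'n) \<times> (real^'m) \<Rightarrow> real) \<Rightarrow> (real^'n) \<times> (real^'m) \<Rightarrow> bool" where
  "is_saddle_point F p \<longleftrightarrow>
    (\<exists>U V. open U \<and> fst p \<in> U \<and> open V \<and> snd p \<in> V \<and>
      (\<forall>x\<in>U. \<forall>z\<in>V. F (fst p, z) \<le> F (fst p, snd p) \<and> F (fst p, snd p) \<le> F (x, snd p)))"

definition Saddle :: "((real^'n) \<times> (real^'m) \<Rightarrow> real) \<Rightarrow> ((real^'n) \<times> (real^'m)) set" where
  "Saddle F = {p. is_saddle_point F p}"


section \<open>Strong quasiconvexity\<close>

definition strongly_quasiconvex_on ::
  "real \<Rightarrow> 'a::real_normed_vector set \<Rightarrow> ('a \<Rightarrow> real) \<Rightarrow> bool" where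
  "strongly_quasiconvex_on s D f \<longleftrightarrow>
    0 < s \<and> convex D \<and>
    (\<forall>x\<in>D. \<forall>y\<in>D. \<forall>l\<in>{0..1}.
      max (f x) (f y) - f (l *\<^sub>R x + (1 - l) *\<^sub>R y) \<ge> s * l * (1 - l) * (norm (x - y))\<^sup>2)"

definition strongly_quasiconcave_on ::
  "real \<Rightarrow> 'a::real_normed_vector set \<Rightarrow> ('a \<Rightarrow> real) \<Rightarrow> bool" where
  "strongly_quasiconcave_on s D f \<longleftrightarrow> strongly_quasiconvex_on s D (\<lambda>x. - f x)"

text \<open>The slices \<open>U \<inter> (\<real>\<^sup>n \<times> {z})\<close> and \<open>U \<inter> ({x} \<times> \<real>\<^sup>m)\<close> are identified with subsets of
  \<open>\<real>\<^sup>n\<close> and \<open>\<real>\<^sup>m\<close>. Strong quasiconvexity over a set includes convexity of that set, so the slices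
  have to be convex (\<open>U\<close> itself need not be).\<close>

definition jointly_sqcc_with ::
  "real \<Rightarrow> ((real^'n) \<times> (real^'m)) set \<Rightarrow> ((real^'n) \<times> (real^'m) \<Rightarrow> real) \<Rightarrow> bool" where
  "jointly_sqcc_with s U F \<longleftrightarrow>
    (\<forall>(x\<^sub>0, z\<^sub>0)\<in>U.
      strongly_quasiconvex_on s {x. (x, z\<^sub>0) \<in> U} (\<lambda>x. F (x, z\<^sub>0)) \<and>
      strongly_quasiconcave_on s {z. (x\<^sub>0, z) \<in> U} (\<lambda>z. F (x\<^sub>0, z)))"

definition locally_jointly_sqcc_at ::
  "((real^'n) \<times> (real^'m) \<Rightarrow> real) \<Rightarrow> (real^'n) \<times> (real^'m) \<Rightarrow> bool" where
  "locally_jointly_sqcc_at F p \<longleftrightarrow>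
    (\<exists>s>0. \<exists>U. open U \<and> p \<in> U \<and> jointly_sqcc_with s U F)"

definition locally_jointly_sqcc_on ::
  "((real^'n) \<times> (real^'m)) set \<Rightarrow> ((real^'n) \<times> (real^'m) \<Rightarrow> real) \<Rightarrow> bool" where
  "locally_jointly_sqcc_on S F \<longleftrightarrow> (\<forall>p\<in>S. locally_jointly_sqcc_at F p)"

definition globally_jointly_sqcc :: "((real^'n) \<times> (real^'m) \<Rightarrow> real) \<Rightarrow> bool" where
  "globally_jointly_sqcc F \<longleftrightarrow> (\<exists>s>0. jointly_sqcc_with s UNIV F)"


section \<open>Isolated path connected components\<close>

definition isolated_path_component :: "'a::topological_space set \<Rightarrow> 'a set \<Rightarrow> bool" where
  "isolated_path_component C S \<longleftrightarrow>
    C \<subseteq> S \<and> path_connected C \<and> (\<exists>U. open U \<and> C \<subseteq> U \<and> U \<inter> S = C)"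


section \<open>Trajectories, stability and convergence to a point\<close>

definition trajectory :: "('a::real_normed_vector \<Rightarrow> 'a) \<Rightarrow> (real \<Rightarrow> 'a) \<Rightarrow> bool" where
  "trajectory X \<gamma> \<longleftrightarrow> (\<forall>t\<ge>0. (\<gamma> has_vector_derivative X (\<gamma> t)) (at t within {0..}))"

definition stable_set :: "('a::real_normed_vector \<Rightarrow> 'a) \<Rightarrow> 'a set \<Rightarrow> bool" where
  "stable_set X S \<longleftrightarrow>
    (\<forall>\<epsilon>>0. \<exists>W. open W \<and> S \<subseteq> W \<and>
      (\<forall>\<gamma>. trajectory X \<gamma> \<and> \<gamma> 0 \<in> W \<longrightarrow> (\<forall>t\<ge>0. infdist (\<gamma> t) S < \<epsilon>)))"

definition attracted_from :: "('a::real_normed_vector \<Rightarrow> 'a) \<Rightarrow> 'a set \<Rightarrow> 'a set \<Rightarrow> bool" where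
  "attracted_from X W S \<longleftrightarrow>
    (\<forall>\<gamma>. trajectory X \<gamma> \<and> \<gamma> 0 \<in> W \<longrightarrow> ((\<lambda>t. infdist (\<gamma> t) S) \<longlongrightarrow> 0) at_top)"

definition locally_asymptotically_stable ::
  "('a::real_normed_vector \<Rightarrow> 'a) \<Rightarrow> 'a set \<Rightarrow> bool" where
  "locally_asymptotically_stable X S \<longleftrightarrow>
    (\<forall>p\<in>S. X p = 0) \<and> stable_set X S \<and>
    (\<exists>W. open W \<and> S \<subseteq> W \<and> attracted_from X W S)"

definition globally_asymptotically_stable ::
  "('a::real_normed_vector \<Rightarrow> 'a) \<Rightarrow> 'a set \<Rightarrow> bool" where
  "globally_asymptotically_stable X S \<longleftrightarrow>
    (\<forall>p\<in>S. X p = 0) \<and> stable_set X S \<and> attracted_from X UNIV S"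

definition pointwise_convergence_from ::
  "('a::real_normed_vector \<Rightarrow> 'a) \<Rightarrow> 'a set \<Rightarrow> 'a set \<Rightarrow> bool" where
  "pointwise_convergence_from X W S \<longleftrightarrow>
    (\<forall>\<gamma>. trajectory X \<gamma> \<and> \<gamma> 0 \<in> W \<longrightarrow> (\<exists>p\<in>S. (\<gamma> \<longlongrightarrow> p) at_top))"

definition local_convergence_to_point ::
  "('a::real_normed_vector \<Rightarrow> 'a) \<Rightarrow> 'a set \<Rightarrow> bool" where
  "local_convergence_to_point X S \<longleftrightarrow>
    (\<exists>W. open W \<and> S \<subseteq> W \<and> pointwise_convergence_from X W S)"

definition global_convergence_to_point ::
  "('a::real_normed_vector \<Rightarrow> 'a) \<Rightarrow> 'a set \<Rightarrow> bool" where
  "global_convergence_to_point X S \<longleftrightarrow> pointwise_convergence_from X UNIV S"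

end

theory Submission
  imports Defs
begin

text \<open>
  The squared distance to a saddle point \<open>q = (x\<^sub>*, z\<^sub>*)\<close> is a strict Lyapunov function. Write
  \<open>u = x - x\<^sub>*\<close> and \<open>w = z - z\<^sub>*\<close>, and let \<open>A\<close> be the matrix of mixed second derivatives. Strong
  quasiconvexity gives \<open>u \<bullet> \<nabla>\<^sub>xF(x, z\<^sub>*) \<ge> s \<parallel>u\<parallel>\<^sup>2\<close> and \<open>- w \<bullet> \<nabla>\<^sub>zF(x\<^sub>*, z) \<ge> s \<parallel>w\<parallel>\<^sup>2\<close>. By the
  mean value theorem and the symmetry of second derivatives, moving the second argument from
  \<open>z\<^sub>*\<close> to \<open>z\<close> and the first one from \<open>x\<^sub>*\<close> to \<open>x\<close> costs \<open>u \<bullet> (A b - A a) w\<close> for two points \<open>a\<close>, \<open>b\<close>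
  of the box spanned by \<open>q\<close> and \<open>p = (x, z)\<close>. This is cubic in \<open>\<parallel>p - q\<parallel>\<close> when \<open>A\<close> is Lipschitz, and
  zero when \<open>A\<close> is constant, so trajectories converge to \<open>q\<close> exponentially. In particular \<open>q\<close> is the
  only equilibrium near it, so isolated path connected components are singletons (or empty).
\<close>

section \<open>Decay of the distance to a point along trajectories\<close>

text \<open>A Gronwall argument: the dissipation inequality makes \<open>\<phi>\<close>, the squared
  distance weighted by \<open>exp (2 * c * t)\<close>, nonincreasing. Since \<open>X\<close> is
  controlled only inside the ball, confinement to the ball has to be proved along with the decay.
  For \<open>c = 0\<close> the result says that the distance never exceeds its initial
  value.\<close>

lemma trajectory_decay:
  fixes X :: "'a::real_inner \<Rightarrow> 'a"
  assumes traj: "trajectory X \<gamma>" and init: "\<gamma> 0 \<in> ball q r"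
    and "0 \<le> c" and X: "\<And>p. p \<in> ball q r \<Longrightarrow> X p \<bullet> (p - q) \<le> - c * (norm (p - q))\<^sup>2"
    and "0 \<le> t"
  shows "norm (\<gamma> t - q) \<le> norm (\<gamma> 0 - q) * exp (- c * t)"
proof -
  have vd: "(\<gamma> has_vector_derivative X (\<gamma> t)) (at t within {0..})" if "0 \<le> t" for t
    using traj that by (auto simp: trajectory_def)
  have cont: "continuous_on {0..} \<gamma>"
    using vd by (auto simp: continuous_on_eq_continuous_within intro: has_vector_derivative_continuous)
  define \<phi> where "\<phi> t = (\<gamma> t - q) \<bullet> (\<gamma> t - q) * exp (2 * c * t)" for t
  have contphi: "continuous_on {0..T} \<phi>" for T
    unfolding \<phi>_def by (intro continuous_intros continuous_on_subset[OF cont]) auto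
  \<comment> \<open>Membership in the ball is required only before \<open>T\<close>, so that this
    also applies when \<open>T\<close> is the exit time itself.\<close>
  have decay: "\<phi> T \<le> \<phi> 0" if "0 \<le> T" and inside: "\<And>t. 0 \<le> t \<Longrightarrow> t < T \<Longrightarrow> \<gamma> t \<in> ball q r" for T
  proof (rule DERIV_nonpos_imp_decreasing_open[OF \<open>0 \<le> T\<close> _ contphi])
    fix t assume t: "0 < t" "t < T"
    then have "at t within {0..} = at t" by (intro at_within_interior) auto
    with vd[of t] t have "(\<gamma> has_vector_derivative X (\<gamma> t)) (at t)" by simp
    then have d: "(\<gamma> has_derivative (\<lambda>h. h *\<^sub>R X (\<gamma> t))) (at t)"
      by (simp add: has_vector_derivative_def)
    let ?d = "2 * exp (2 * c * t) * (X (\<gamma> t) \<bullet> (\<gamma> t - q) + c * (norm (\<gamma> t - q))\<^sup>2)"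
    have "(\<phi> has_derivative (\<lambda>h. ?d * h)) (at t)"
      unfolding \<phi>_def
      by (rule derivative_eq_intros d refl)+
        (auto simp: fun_eq_iff algebra_simps inner_commute power2_norm_eq_inner)
    then have "DERIV \<phi> t :> ?d" by (simp add: has_field_derivative_def)
    moreover have "?d \<le> 0"
      using X[OF inside[of t]] t by (auto intro!: mult_nonneg_nonpos)
    ultimately show "\<exists>y. DERIV \<phi> t :> y \<and> y \<le> 0" by blast
  qed
  have bound: "norm (\<gamma> T - q) \<le> norm (\<gamma> 0 - q) * exp (- c * T)" if "\<phi> T \<le> \<phi> 0" for T
  proof -
    have "exp (2 * c * T) = (exp (c * T))\<^sup>2"
      by (simp add: power2_eq_square flip: exp_add)
    then have "(norm (\<gamma> T - q) * exp (c * T))\<^sup>2 \<le> (norm (\<gamma> 0 - q))\<^sup>2"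
      using that by (simp add: \<phi>_def power_mult_distrib power2_norm_eq_inner)
    then have "norm (\<gamma> T - q) * exp (c * T) \<le> norm (\<gamma> 0 - q)"
      by (rule power2_le_imp_le) simp
    then show ?thesis by (simp add: exp_minus field_simps)
  qed
  \<comment> \<open>Otherwise there is a first exit time, and the decay up to it contradicts the exit.\<close>
  have stays: "\<gamma> T \<in> ball q r" if "0 \<le> T" for T
  proof (rule ccontr)
    assume "\<gamma> T \<notin> ball q r"
    define A where "A = {0..} \<inter> (\<lambda>t. dist q (\<gamma> t)) -` {r..}"
    have "closed A"
      unfolding A_def
      by (intro continuous_closed_preimage continuous_on_dist continuous_on_const cont closed_atLeast)
    moreover have "A \<noteq> {}" using that \<open>\<gamma> T \<notin> ball q r\<close> by (auto simp: A_def)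
    moreover have bdd: "bdd_below A" by (auto simp: A_def)
    ultimately have "Inf A \<in> A" by (intro closed_contains_Inf)
    then have "0 \<le> Inf A" and out: "r \<le> dist q (\<gamma> (Inf A))" by (auto simp: A_def)
    have "\<gamma> t \<in> ball q r" if "0 \<le> t" "t < Inf A" for t
    proof -
      have "t \<notin> A" using cInf_lower[OF _ bdd, of t] that by force
      then show ?thesis using that by (simp add: A_def)
    qed
    then have "\<phi> (Inf A) \<le> \<phi> 0" using \<open>0 \<le> Inf A\<close> by (intro decay)
    from bound[OF this] have "norm (\<gamma> (Inf A) - q) \<le> norm (\<gamma> 0 - q) * exp (- c * Inf A)" .
    also have "\<dots> \<le> norm (\<gamma> 0 - q) * 1"
      using \<open>0 \<le> c\<close> \<open>0 \<le> Inf A\<close> by (intro mult_left_mono) auto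
    finally show False using out init by (simp add: dist_norm norm_minus_commute)
  qed
  show ?thesis using bound[OF decay[OF \<open>0 \<le> t\<close> stays]] by simp
qed

section \<open>Strong quasiconvexity near a local minimiser\<close>

text \<open>If \<open>f y\<close> were below \<open>f x\<close>, every interior point of the segment
  would have a value strictly below \<open>f x\<close>. Such points lie in \<open>V\<close> as soon
  as they are close enough to \<open>x\<close>, which contradicts local minimality.\<close>

lemma strongly_quasiconvex_on_local_min:
  assumes sq: "strongly_quasiconvex_on s D f" and x: "x \<in> D" "y \<in> D"
    and "open V" "x \<in> V" and min: "\<And>v. v \<in> V \<Longrightarrow> f x \<le> f v"
  shows "f x \<le> f y"
proof (rule ccontr)
  assume "\<not> f x \<le> f y"
  then have less: "f y < f x" and "y \<noteq> x" by auto
  have "((\<lambda>l. (1 - l) *\<^sub>R y + l *\<^sub>R x) \<longlongrightarrow> (1 - 1) *\<^sub>R y + 1 *\<^sub>R x) (at_left 1)"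
    by (intro tendsto_intros)
  then have "\<forall>\<^sub>F l in at_left 1. (1 - l) *\<^sub>R y + l *\<^sub>R x \<in> V"
    using \<open>open V\<close> \<open>x \<in> V\<close> by (intro topological_tendstoD) auto
  moreover have "\<forall>\<^sub>F l in at_left (1::real). l \<in> {0<..<1}"
    by (rule eventually_at_left_real) simp
  ultimately have "\<forall>\<^sub>F l in at_left (1::real). False"
  proof eventually_elim
    case (elim l)
    have "0 < s" using sq by (simp add: strongly_quasiconvex_on_def)
    then have "0 < s * l * (1 - l) * (norm (x - y))\<^sup>2" using elim(2) \<open>y \<noteq> x\<close> by simp
    also have "\<dots> \<le> max (f x) (f y) - f (l *\<^sub>R x + (1 - l) *\<^sub>R y)"
      using sq x elim(2) unfolding strongly_quasiconvex_on_def by force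
    also have "\<dots> \<le> 0" using min[OF elim(1)] less by (simp add: add.commute)
    finally show False by simp
  qed
  then show False by simp
qed

text \<open>Since \<open>f x \<le> f y\<close>, the maximum in the definition is \<open>f y\<close>.
  Taking a step of size \<open>t\<close> from \<open>y\<close> towards \<open>x\<close>, dividing by
  \<open>t\<close> and letting \<open>t\<close> tend to 0 from the right leaves the directional
  derivative on one side and the quadratic term on the other.\<close>

lemma strongly_quasiconvex_on_derivative:
  assumes sq: "strongly_quasiconvex_on s D f" and x: "x \<in> D" "y \<in> D"
    and "open V" "x \<in> V" and min: "\<And>v. v \<in> V \<Longrightarrow> f x \<le> f v"
    and d: "(f has_derivative f') (at y)"
  shows "s * (norm (y - x))\<^sup>2 \<le> f' (y - x)"
proof -
  have le: "f x \<le> f y"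
    using strongly_quasiconvex_on_local_min[OF sq x \<open>open V\<close> \<open>x \<in> V\<close> min] .
  define g where "g t = f (y + t *\<^sub>R (x - y))" for t
  have "(f has_derivative f') (at (y + 0 *\<^sub>R (x - y)))" using d by simp
  then have "(g has_derivative (\<lambda>h. f' (h *\<^sub>R (x - y)))) (at 0)"
    unfolding g_def by (rule has_derivative_compose[rotated]) (auto intro!: derivative_eq_intros)
  then have "(g has_derivative (\<lambda>h. h * f' (x - y))) (at 0)"
    using linear_cmul[OF has_derivative_linear[OF d]] by simp
  then have "DERIV g 0 :> f' (x - y)"
    by (simp add: has_field_derivative_def mult_commute_abs)
  then have "((\<lambda>t. (g t - g 0) / (t - 0)) \<longlongrightarrow> f' (x - y)) (at 0)"
    by (simp only: has_field_derivative_iff)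
  then have lim1: "((\<lambda>t. (g t - g 0) / t) \<longlongrightarrow> f' (x - y)) (at_right 0)"
    by (simp add: filterlim_at_split)
  have lim2: "((\<lambda>t. - (s * (1 - t) * (norm (x - y))\<^sup>2)) \<longlongrightarrow> - (s * (1 - 0) * (norm (x - y))\<^sup>2)) (at_right 0)"
    by (intro tendsto_intros)
  have "\<forall>\<^sub>F t in at_right (0::real). t \<in> {0<..<1}"
    by (rule eventually_at_right_real) simp
  then have "\<forall>\<^sub>F t in at_right 0. (g t - g 0) / t \<le> - (s * (1 - t) * (norm (x - y))\<^sup>2)"
  proof eventually_elim
    case (elim t)
    then have "s * t * (1 - t) * (norm (x - y))\<^sup>2 \<le> max (f x) (f y) - f (t *\<^sub>R x + (1 - t) *\<^sub>R y)"
      using sq x unfolding strongly_quasiconvex_on_def by force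
    also have "\<dots> = g 0 - g t" using le by (simp add: g_def algebra_simps)
    finally have "g t - g 0 \<le> - (s * (1 - t) * (norm (x - y))\<^sup>2) * t" by (simp add: algebra_simps)
    then show ?case using elim by (simp only: pos_divide_le_eq greaterThanLessThan_iff)
  qed
  from tendsto_le[OF _ lim2 lim1 this]
  have "f' (x - y) \<le> - (s * (norm (x - y))\<^sup>2)" by simp
  moreover have "f' (y - x) = - f' (x - y)"
    using linear_neg[OF has_derivative_linear[OF d], of "x - y"] by simp
  ultimately show ?thesis by (simp add: norm_minus_commute)
qed

section \<open>Mean value theorems and symmetry of the second derivative\<close>

lemma mvt_line:
  fixes f :: "'a::real_normed_vector \<Rightarrow> real"
  assumes "\<And>x. (f has_derivative f' x) (at x)" and "0 < h"
  obtains t where "0 < t" "t < h" "f (p + h *\<^sub>R v) - f p = h * f' (p + t *\<^sub>R v) v"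
proof -
  have d: "((\<lambda>t. f (p + t *\<^sub>R v)) has_derivative (\<lambda>k. k * f' (p + t *\<^sub>R v) v)) (at t)" for t
  proof -
    have "((\<lambda>t. f (p + t *\<^sub>R v)) has_derivative (\<lambda>k. f' (p + t *\<^sub>R v) (k *\<^sub>R v))) (at t)"
      by (rule has_derivative_compose[OF _ assms(1)]) (auto intro!: derivative_eq_intros)
    then show ?thesis using linear_cmul[OF has_derivative_linear[OF assms(1)]] by simp
  qed
  have "continuous_on {0..h} (\<lambda>t. f (p + t *\<^sub>R v))"
    using d by (intro has_derivative_continuous_on) (blast intro: has_derivative_at_withinI)
  from mvt[OF \<open>0 < h\<close> this d] that show ?thesis by auto
qed

text \<open>The mean value theorem is used twice, each time contributing a factor \<open>h\<close>:
  along \<open>a\<close> for the increment \<open>G\<close> of \<open>F\<close> in direction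
  \<open>b\<close>, then along \<open>b\<close> for the derivative of \<open>F\<close> in direction
  \<open>a\<close>.\<close>

lemma second_difference_mvt:
  fixes F :: "'a::real_normed_vector \<Rightarrow> real"
  assumes F': "\<And>x. (F has_derivative blinfun_apply (F' x)) (at x)"
    and F'': "\<And>x. (F' has_derivative blinfun_apply (F'' x)) (at x)" and "0 < h"
  obtains s t where "0 < s" "s < h" "0 < t" "t < h"
    "F (p + h *\<^sub>R a + h *\<^sub>R b) - F (p + h *\<^sub>R a) - F (p + h *\<^sub>R b) + F p =
      h\<^sup>2 * F'' (p + s *\<^sub>R a + t *\<^sub>R b) b a"
proof -
  define G where "G x = F (x + h *\<^sub>R b) - F x" for x
  have "(G has_derivative (\<lambda>k. F' (x + h *\<^sub>R b) k - F' x k)) (at x)" for x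
  proof -
    have "((\<lambda>x. x + h *\<^sub>R b) has_derivative (\<lambda>k. k)) (at x)"
      by (auto intro!: derivative_eq_intros)
    from has_derivative_compose[OF this F'] show ?thesis
      unfolding G_def by (intro has_derivative_diff F')
  qed
  from mvt_line[OF this \<open>0 < h\<close>] obtain s where s: "0 < s" "s < h"
    "G (p + h *\<^sub>R a) - G p = h * (F' (p + s *\<^sub>R a + h *\<^sub>R b) a - F' (p + s *\<^sub>R a) a)" .
  have "((\<lambda>x. F' x a) has_derivative (\<lambda>k. F'' x k a)) (at x)" for x
    by (rule bounded_linear.has_derivative[OF blinfun.bounded_linear_left F''])
  from mvt_line[OF this \<open>0 < h\<close>] obtain t where t: "0 < t" "t < h"
    "F' (p + s *\<^sub>R a + h *\<^sub>R b) a - F' (p + s *\<^sub>R a) a = h * F'' (p + s *\<^sub>R a + t *\<^sub>R b) b a" .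
  from s t show ?thesis
    by (intro that[of s t]) (simp_all add: G_def power2_eq_square algebra_simps)
qed

text \<open>The second difference of \<open>F\<close> along \<open>a\<close> and \<open>b\<close> is symmetric in \<open>a\<close> and \<open>b\<close>, and divided by
  \<open>h\<^sup>2\<close> it is a value of either mixed second derivative near \<open>p\<close>.\<close>

lemma second_derivative_symmetric:
  fixes F :: "'a::real_normed_vector \<Rightarrow> real"
  assumes F': "\<And>x. (F has_derivative blinfun_apply (F' x)) (at x)"
    and F'': "\<And>x. (F' has_derivative blinfun_apply (F'' x)) (at x)"
    and cont: "continuous_on UNIV F''"
  shows "F'' p a b = F'' p b a"
proof -
  have tends: "((\<lambda>x. F'' x u v) \<longlongrightarrow> F'' p u v) (at p)" for u v
    using cont by (intro tendsto_intros) (simp add: continuous_on_eq_continuous_at isCont_def)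
  have "\<bar>F'' p a b - F'' p b a\<bar> \<le> e" if "0 < e" for e
  proof -
    have c: "isCont (\<lambda>x. F'' x u v) p" for u v
      using tends by (simp add: isCont_def)
    have "\<exists>d>0. \<forall>x. dist x p < d \<longrightarrow> dist (F'' x u v) (F'' p u v) < e / 2" for u v
      using c[of u v] half_gt_zero[OF that] unfolding continuous_at_eps_delta by blast
    then obtain d where d: "\<And>u v. 0 < d u v"
      "\<And>u v x. dist x p < d u v \<Longrightarrow> dist (F'' x u v) (F'' p u v) < e / 2"
      by metis
    \<comment> \<open>Small enough that displacements along \<open>a\<close> and \<open>b\<close>
      with coefficients below \<open>h\<close> stay within both continuity radii; the summand 1
      keeps the denominator positive when \<open>a\<close> and \<open>b\<close> vanish.\<close>
    define h where "h = min (d a b) (d b a) / (norm a + norm b + 1)"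
    have pos: "0 < norm a + norm b + 1" by (simp add: add_nonneg_pos)
    then have h: "0 < h" using d(1) by (simp add: h_def)
    have near: "dist (p + s *\<^sub>R a' + t *\<^sub>R b') p < min (d a b) (d b a)"
      if "0 < s" "s < h" "0 < t" "t < h" "norm a' + norm b' = norm a + norm b" for s t a' b'
    proof -
      have "dist (p + s *\<^sub>R a' + t *\<^sub>R b') p \<le> norm (s *\<^sub>R a') + norm (t *\<^sub>R b')"
        by (simp add: dist_norm norm_triangle_ineq add.assoc del: norm_scaleR)
      also have "\<dots> \<le> h * norm a' + h * norm b'"
        using that by (intro add_mono) (auto intro: mult_right_mono)
      also have "\<dots> = h * (norm a + norm b)" using that by (simp flip: distrib_left)
      also have "\<dots> < h * (norm a + norm b + 1)" using h by simp
      also have "\<dots> = min (d a b) (d b a)" using pos by (simp add: h_def)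
      finally show ?thesis .
    qed
    let ?D = "F (p + h *\<^sub>R a + h *\<^sub>R b) - F (p + h *\<^sub>R a) - F (p + h *\<^sub>R b) + F p"
    obtain s t where st: "0 < s" "s < h" "0 < t" "t < h"
      "?D = h\<^sup>2 * F'' (p + s *\<^sub>R a + t *\<^sub>R b) b a"
      using second_difference_mvt[OF F' F'' h] by blast
    obtain s' t' where st': "0 < s'" "s' < h" "0 < t'" "t' < h"
      "F (p + h *\<^sub>R b + h *\<^sub>R a) - F (p + h *\<^sub>R b) - F (p + h *\<^sub>R a) + F p =
        h\<^sup>2 * F'' (p + s' *\<^sub>R b + t' *\<^sub>R a) a b"
      using second_difference_mvt[OF F' F'' h] by blast
    have swap: "p + h *\<^sub>R b + h *\<^sub>R a = p + h *\<^sub>R a + h *\<^sub>R b" by simp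
    have "h\<^sup>2 * F'' (p + s *\<^sub>R a + t *\<^sub>R b) b a = h\<^sup>2 * F'' (p + s' *\<^sub>R b + t' *\<^sub>R a) a b"
      using st(5) st'(5) unfolding swap by linarith
    then have "F'' (p + s *\<^sub>R a + t *\<^sub>R b) b a = F'' (p + s' *\<^sub>R b + t' *\<^sub>R a) a b"
      using h by simp
    moreover have "dist (F'' (p + s *\<^sub>R a + t *\<^sub>R b) b a) (F'' p b a) < e / 2"
      using near[OF st(1-4)] by (intro d(2)) simp
    moreover have "dist (F'' (p + s' *\<^sub>R b + t' *\<^sub>R a) a b) (F'' p a b) < e / 2"
      using near[OF st'(1-4), of b a] by (intro d(2)) simp
    ultimately show ?thesis by (simp add: dist_real_def abs_if split: if_splits)
  qed
  then have "\<bar>F'' p a b - F'' p b a\<bar> \<le> 0" by (rule field_le_epsilon) simp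
  then show ?thesis by simp
qed

section \<open>Gradients, partial derivatives and norm estimates\<close>

text \<open>As \<open>grad\<close> is a definite description, its value needs existence and
  uniqueness: the adjoint of the derivative applied to 1 represents it as an inner product, and
  derivatives are unique.\<close>

lemma inner_grad:
  fixes f :: "'a::euclidean_space \<Rightarrow> real"
  assumes "(f has_derivative f') (at x)"
  shows "h \<bullet> grad f x = f' h"
proof -
  have adj: "h \<bullet> adjoint f' 1 = f' h" for h
    using adjoint_works[OF has_derivative_linear[OF assms]] by simp
  have "grad f x = adjoint f' 1"
    unfolding grad_def
  proof (rule the_equality)
    show "GDERIV f x :> adjoint f' 1" using assms by (simp add: gderiv_def adj)
    fix D assume "GDERIV f x :> D"
    then have "(\<lambda>h. h \<bullet> D) = f'" using assms unfolding gderiv_def by (rule has_derivative_unique)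
    then show "D = adjoint f' 1" by (metis adj vector_eq_ldot)
  qed
  with adj show ?thesis by simp
qed

lemma partial_derivatives:
  fixes F :: "'a::real_normed_vector \<times> 'b::real_normed_vector \<Rightarrow> 'c::real_normed_vector"
  assumes "\<And>p. (F has_derivative F' p) (at p)"
  shows "((\<lambda>x. F (x, z)) has_derivative (\<lambda>h. F' (x, z) (h, 0))) (at x)"
    and "((\<lambda>z. F (x, z)) has_derivative (\<lambda>h. F' (x, z) (0, h))) (at z)"
  by (rule has_derivative_compose[OF _ assms]; auto intro!: derivative_eq_intros)+

text \<open>Cauchy-Schwarz in each row. The factor is not sharp; it enters only the constant of the
  cubic error term.\<close>

lemma norm_matrix_vector_le:
  fixes A :: "real^'m^'n"
  shows "norm (A *v w) \<le> CARD('n) * norm A * norm w"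
proof -
  have "norm (A *v w) \<le> (\<Sum>i\<in>UNIV. \<bar>(A *v w) $ i\<bar>)"
    by (rule norm_le_l1_cart)
  also have "\<dots> \<le> (\<Sum>i\<in>(UNIV::'n set). norm A * norm w)"
  proof (rule sum_mono)
    fix i
    have "\<bar>(A *v w) $ i\<bar> \<le> norm (A $ i) * norm w"
      by (simp add: matrix_mult_dot Cauchy_Schwarz_ineq2)
    also have "\<dots> \<le> norm A * norm w"
      by (intro mult_right_mono Finite_Cartesian_Product.norm_nth_le) simp
    finally show "\<bar>(A *v w) $ i\<bar> \<le> norm A * norm w" .
  qed
  finally show ?thesis by simp
qed

text \<open>Keeps points of the box spanned by \<open>q\<close> and \<open>p\<close> within the ball
  around \<open>q\<close>, and bounds the distance between two of them.\<close>

lemma norm_Pair_scaleR_le: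
  assumes "\<bar>a\<bar> \<le> 1" "\<bar>b\<bar> \<le> 1"
  shows "norm (a *\<^sub>R u, b *\<^sub>R w) \<le> norm (u, w)"
proof -
  have "norm (a *\<^sub>R u) \<le> norm u" "norm (b *\<^sub>R w) \<le> norm w"
    using assms by (simp_all add: mult_left_le_one_le)
  then show ?thesis
    unfolding norm_Pair by (intro real_sqrt_le_mono add_mono power_mono) auto
qed

lemma local_min_derivative:
  fixes f :: "'a::euclidean_space \<Rightarrow> real"
  assumes "(f has_derivative f') (at x)" "open V" "x \<in> V" "\<And>v. v \<in> V \<Longrightarrow> f x \<le> f v"
  shows "f' = (\<lambda>h. 0)"
  using differential_zero_maxmin[of x V f f'] assms by blast

section \<open>Dissipation of the saddle-point dynamics\<close>

context
  fixes F :: "(real^'n) \<times> (real^'m) \<Rightarrow> real" and F' F''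
  assumes F': "\<And>p. (F has_derivative blinfun_apply (F' p)) (at p)"
    and F'': "\<And>p. (F' has_derivative blinfun_apply (F'' p)) (at p)"
    and F''_cont: "continuous_on UNIV F''"
begin

lemma inner_grad_x: "u \<bullet> grad_x F p = F' p (u, 0)"
  using inner_grad[OF partial_derivatives(1)[OF F']] by (simp add: grad_x_def)

lemma inner_grad_z: "w \<bullet> grad_z F p = F' p (0, w)"
  using inner_grad[OF partial_derivatives(2)[OF F']] by (simp add: grad_z_def)

lemma F'_apply_derivative:
  "((\<lambda>p. F' p v) has_derivative (\<lambda>k. F'' p k v)) (at p)"
  by (rule bounded_linear.has_derivative[OF blinfun.bounded_linear_left F''])

text \<open>The \<open>jacobian\<close> represents the derivative only once differentiability is
  known. As \<open>grad_x\<close> is accessible through inner products, differentiability is checked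
  componentwise, and uniqueness of derivatives then identifies the matrix.\<close>

lemma inner_grad_xz: "u \<bullet> (grad_xz F p *v w) = F'' p (0, w) (u, 0)"
proof -
  let ?g = "\<lambda>z. grad_x F (fst p, z)"
  have d: "((\<lambda>z. u \<bullet> ?g z) has_derivative (\<lambda>w. F'' p (0, w) (u, 0))) (at (snd p))" for u
    using partial_derivatives(2)[OF F'_apply_derivative, where x = "fst p" and z = "snd p"]
    by (simp add: inner_grad_x)
  have "(\<lambda>z. ?g z \<bullet> i) differentiable (at (snd p))" for i
    using d[of i] by (auto simp: differentiable_def inner_commute)
  then have "?g differentiable (at (snd p))"
    by (simp add: differentiable_componentwise_within[of ?g])
  then have "(?g has_derivative (*v) (grad_xz F p)) (at (snd p))"
    by (simp add: jacobian_works grad_xz_def)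
  then have "((\<lambda>z. u \<bullet> ?g z) has_derivative (\<lambda>w. u \<bullet> (grad_xz F p *v w))) (at (snd p))"
    by (rule has_derivative_inner_right)
  from has_derivative_unique[OF this d] show ?thesis by meson
qed

lemma Saddle_equilibrium:
  assumes "p \<in> Saddle F"
  shows "X_sp F p = 0"
proof -
  obtain U V where UV: "open U" "fst p \<in> U" "open V" "snd p \<in> V"
    "\<And>x. x \<in> U \<Longrightarrow> F (fst p, snd p) \<le> F (x, snd p)"
    "\<And>z. z \<in> V \<Longrightarrow> F (fst p, z) \<le> F (fst p, snd p)"
    using assms unfolding Saddle_def is_saddle_point_def by blast
  have "(\<lambda>h. F' p (h, 0)) = (\<lambda>h. 0)"
    using local_min_derivative[OF partial_derivatives(1)[OF F'] UV(1,2,5)] by simp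
  then have x: "u \<bullet> grad_x F p = 0" for u by (simp add: inner_grad_x fun_eq_iff)
  have "(\<lambda>h. - F' p (0, h)) = (\<lambda>h. 0)"
    using local_min_derivative[OF has_derivative_minus[OF partial_derivatives(2)[OF F', of "fst p"]]
        UV(3,4)] UV(6)
    by simp
  then have z: "w \<bullet> grad_z F p = 0" for w by (simp add: inner_grad_z fun_eq_iff)
  from x[of "grad_x F p"] z[of "grad_z F p"] show ?thesis by (simp add: X_sp_def zero_prod_def)
qed

text \<open>By the mean value theorem both differences are values of the form given by
  \<open>grad_xz\<close>, at \<open>b\<close> and at \<open>a\<close>. The opposite signs in the
  dynamics leave only the variation of \<open>grad_xz\<close> between them; this variation,
  \<open>u\<close> and \<open>w\<close> each contribute one factor
  \<open>norm (p - q)\<close>.\<close>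

lemma coupling_bound:
  assumes lip: "L-lipschitz_on (ball q r) (grad_xz F)" and p: "p \<in> ball q r"
  defines "u \<equiv> fst p - fst q" and "w \<equiv> snd p - snd q"
  shows "w \<bullet> (grad_z F p - grad_z F (fst q, snd p)) - u \<bullet> (grad_x F p - grad_x F (fst p, snd q))
    \<le> real CARD('n) * L * norm (p - q) ^ 3"
proof -
  have pq: "p - q = (u, w)" by (simp add: u_def w_def prod_eq_iff)
  \<comment> \<open>The point \<open>a\<close> lies on the edge of the box from
    \<open>(fst p, snd q)\<close> to \<open>p\<close>, and \<open>b\<close> below on the edge from
    \<open>(fst q, snd p)\<close> to \<open>p\<close>.\<close>
  obtain t where t: "0 < t" "t < 1"
    "F' ((fst p, snd q) + 1 *\<^sub>R (0, w)) (u, 0) - F' (fst p, snd q) (u, 0) =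
      1 * F'' ((fst p, snd q) + t *\<^sub>R (0, w)) (0, w) (u, 0)"
    using mvt_line[OF F'_apply_derivative zero_less_one] by blast
  obtain s where s: "0 < s" "s < 1"
    "F' ((fst q, snd p) + 1 *\<^sub>R (u, 0)) (0, w) - F' (fst q, snd p) (0, w) =
      1 * F'' ((fst q, snd p) + s *\<^sub>R (u, 0)) (u, 0) (0, w)"
    using mvt_line[OF F'_apply_derivative zero_less_one] by blast
  define a where "a = (fst p, snd q) + t *\<^sub>R (0, w)"
  define b where "b = (fst q, snd p) + s *\<^sub>R (u, 0)"
  have diffs: "a - q = (1 *\<^sub>R u, t *\<^sub>R w)" "b - q = (s *\<^sub>R u, 1 *\<^sub>R w)"
    "b - a = ((s - 1) *\<^sub>R u, (1 - t) *\<^sub>R w)"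
    by (simp_all add: a_def b_def u_def w_def prod_eq_iff algebra_simps)
  have le: "norm (a - q) \<le> norm (p - q)" "norm (b - q) \<le> norm (p - q)"
    "norm (b - a) \<le> norm (p - q)"
    unfolding diffs pq by (rule norm_Pair_scaleR_le; use s t in simp)+
  then have ab: "a \<in> ball q r" "b \<in> ball q r"
    using p by (auto simp: dist_norm norm_minus_commute)
  have L: "0 \<le> L" using lip by (rule lipschitz_on_nonneg)
  have "norm (grad_xz F b - grad_xz F a) \<le> L * norm (b - a)"
    using lipschitz_onD[OF lip ab(2,1)] by (simp add: dist_norm)
  also have "\<dots> \<le> L * norm (p - q)" using le L by (intro mult_left_mono)
  finally have A: "norm (grad_xz F b - grad_xz F a) \<le> L * norm (p - q)" .
  have uw: "norm u \<le> norm (p - q)" "norm w \<le> norm (p - q)"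
    unfolding pq norm_Pair by (auto intro: real_le_rsqrt)
  have ends: "(fst p, snd q) + 1 *\<^sub>R (0, w) = p" "(fst q, snd p) + 1 *\<^sub>R (u, 0) = p"
    by (simp_all add: u_def w_def prod_eq_iff)
  have "u \<bullet> (grad_x F p - grad_x F (fst p, snd q)) = u \<bullet> (grad_xz F a *v w)"
    using t(3) unfolding ends a_def[symmetric]
    by (simp add: inner_diff_right inner_grad_x inner_grad_xz)
  \<comment> \<open>Here the \<open>z\<close>-gradient is differentiated in \<open>x\<close>,
    whereas \<open>grad_xz\<close> differentiates the \<open>x\<close>-gradient in \<open>z\<close>;
    symmetry of the second derivative reconciles the two.\<close>
  moreover have "w \<bullet> (grad_z F p - grad_z F (fst q, snd p)) = u \<bullet> (grad_xz F b *v w)"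
    using s(3) second_derivative_symmetric[OF F' F'' F''_cont, of b "(u, 0)" "(0, w)"]
    unfolding ends b_def[symmetric]
    by (simp add: inner_diff_right inner_grad_z inner_grad_xz)
  ultimately have "w \<bullet> (grad_z F p - grad_z F (fst q, snd p)) -
      u \<bullet> (grad_x F p - grad_x F (fst p, snd q)) = u \<bullet> ((grad_xz F b - grad_xz F a) *v w)"
    by (simp add: inner_diff_right matrix_vector_mult_diff_rdistrib)
  also have "\<dots> \<le> norm u * (CARD('n) * norm (grad_xz F b - grad_xz F a) * norm w)"
    by (intro order_trans[OF norm_cauchy_schwarz] mult_left_mono norm_matrix_vector_le) simp
  also have "\<dots> \<le> norm (p - q) * (CARD('n) * (L * norm (p - q)) * norm (p - q))"
    using L by (intro mult_mono A uw) auto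
  finally show ?thesis by (simp add: power3_eq_cube algebra_simps)
qed

text \<open>Each gradient at \<open>p\<close> is compared with the one on the slice through
  \<open>q\<close>. On the slices the derivative bound for strongly quasiconvex functions yields the
  quadratic term; the comparison costs the coupling term.\<close>

lemma saddle_dissipation:
  assumes q: "q \<in> Saddle F" and sq: "jointly_sqcc_with s U F" and U: "ball q r \<subseteq> U"
    and lip: "L-lipschitz_on (ball q r) (grad_xz F)" and p: "p \<in> ball q r"
  shows "X_sp F p \<bullet> (p - q) \<le> - s * (norm (p - q))\<^sup>2 + real CARD('n) * L * norm (p - q) ^ 3"
proof -
  define u where "u = fst p - fst q"
  define w where "w = snd p - snd q"
  have pq: "p - q = (u, w)" by (simp add: u_def w_def prod_eq_iff)
  \<comment> \<open>The other two corners of the box are no farther from \<open>q\<close> than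
    \<open>p\<close>, hence lie in \<open>U\<close>.\<close>
  have "norm (1 *\<^sub>R u, 0 *\<^sub>R w) \<le> norm (u, w)" "norm (0 *\<^sub>R u, 1 *\<^sub>R w) \<le> norm (u, w)"
    by (intro norm_Pair_scaleR_le; simp)+
  moreover have "(fst p, snd q) - q = (u, 0)" "(fst q, snd p) - q = (0, w)"
    by (simp_all add: u_def w_def prod_eq_iff)
  moreover have "x \<in> U" if "norm (x - q) \<le> norm (p - q)" for x
    using that p U by (force simp: dist_norm norm_minus_commute)
  ultimately have mem: "(fst p, snd q) \<in> U" "(fst q, snd p) \<in> U" "q \<in> U"
    by (simp_all add: pq)
  obtain V W where VW: "open V" "fst q \<in> V" "open W" "snd q \<in> W"
    "\<And>x. x \<in> V \<Longrightarrow> F (fst q, snd q) \<le> F (x, snd q)"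
    "\<And>z. z \<in> W \<Longrightarrow> - F (fst q, snd q) \<le> - F (fst q, z)"
    using q unfolding Saddle_def is_saddle_point_def neg_le_iff_le by blast
  have sqx: "strongly_quasiconvex_on s {x. (x, snd q) \<in> U} (\<lambda>x. F (x, snd q))"
    and sqz: "strongly_quasiconvex_on s {z. (fst q, z) \<in> U} (\<lambda>z. - F (fst q, z))"
    using sq mem(3) unfolding jointly_sqcc_with_def strongly_quasiconcave_on_def by auto
  have "s * (norm u)\<^sup>2 \<le> F' (fst p, snd q) (u, 0)"
    unfolding u_def
    by (rule strongly_quasiconvex_on_derivative[OF sqx _ _ VW(1,2,5) partial_derivatives(1)[OF F']])
      (use mem in auto)
  then have x: "s * (norm u)\<^sup>2 \<le> u \<bullet> grad_x F (fst p, snd q)" by (simp add: inner_grad_x)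
  have "s * (norm w)\<^sup>2 \<le> - F' (fst q, snd p) (0, w)"
    unfolding w_def
    by (rule strongly_quasiconvex_on_derivative[OF sqz _ _ VW(3,4,6)
          has_derivative_minus[OF partial_derivatives(2)[OF F']]])
      (use mem in auto)
  then have z: "s * (norm w)\<^sup>2 \<le> - (w \<bullet> grad_z F (fst q, snd p))" by (simp add: inner_grad_z)
  have "(norm (p - q))\<^sup>2 = (norm u)\<^sup>2 + (norm w)\<^sup>2" by (simp add: pq norm_Pair)
  then have "s * (norm (p - q))\<^sup>2 = s * (norm u)\<^sup>2 + s * (norm w)\<^sup>2" by (simp add: distrib_left)
  moreover have "X_sp F p \<bullet> (p - q) = w \<bullet> grad_z F p - u \<bullet> grad_x F p"
    by (simp add: X_sp_def pq inner_commute)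
  ultimately show ?thesis
    using coupling_bound[OF lip p] x z by (simp add: inner_diff_right flip: u_def w_def)
qed

lemma saddle_local_dissipation:
  assumes lip: "locally_lipschitz (grad_xz F)" and q: "q \<in> Saddle F"
    and sq: "locally_jointly_sqcc_at F q"
  obtains c r where "0 < c" "0 < r"
    "\<And>p. p \<in> ball q r \<Longrightarrow> X_sp F p \<bullet> (p - q) \<le> - c * (norm (p - q))\<^sup>2"
proof -
  obtain s U where s: "0 < s" "open U" "q \<in> U" "jointly_sqcc_with s U F"
    using sq unfolding locally_jointly_sqcc_at_def by blast
  obtain r1 where r1: "0 < r1" "ball q r1 \<subseteq> U"
    using s(2,3) open_contains_ball by blast
  obtain r2 L where r2: "0 < r2" "L-lipschitz_on (ball q r2) (grad_xz F)"
    using lip unfolding locally_lipschitz_def by blast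
  have L: "0 \<le> L" using r2(2) by (rule lipschitz_on_nonneg)
  define K where "K = real CARD('n) * L"
  have K: "0 \<le> K" using L by (simp add: K_def)
  \<comment> \<open>The third bound lets the cubic term consume at most half of the quadratic one;
    \<open>K + 1\<close> replaces \<open>K\<close>, which may be zero.\<close>
  define r where "r = Min {r1, r2, s / (2 * (K + 1))}"
  have r: "0 < r" "r \<le> r1" "r \<le> r2" "r \<le> s / (2 * (K + 1))"
    using s r1 r2 K by (auto simp: r_def)
  have Kr: "K * d \<le> s / 2" if "0 \<le> d" "d \<le> r" for d
  proof -
    have "K * d \<le> (K + 1) * (s / (2 * (K + 1)))"
      using that r K by (intro mult_mono) auto
    also have "\<dots> = s / 2" using K by (simp add: field_simps)
    finally show ?thesis .
  qed
  show ?thesis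
  proof (rule that[of "s / 2" r])
    fix p assume p: "p \<in> ball q r"
    have "X_sp F p \<bullet> (p - q) \<le> - s * (norm (p - q))\<^sup>2 + K * norm (p - q) ^ 3"
      unfolding K_def
    proof (rule saddle_dissipation[OF q s(4) _ _ p])
      show "ball q r \<subseteq> U" using r1 r by (meson subset_ball subset_trans)
      show "L-lipschitz_on (ball q r) (grad_xz F)"
        using r2(2) by (rule lipschitz_on_subset) (use r in \<open>simp add: subset_ball\<close>)
    qed
    also have "K * norm (p - q) ^ 3 = K * norm (p - q) * (norm (p - q))\<^sup>2"
      by (simp add: power3_eq_cube power2_eq_square)
    also have "\<dots> \<le> s / 2 * (norm (p - q))\<^sup>2"
      using p by (intro mult_right_mono Kr) (auto simp: dist_norm norm_minus_commute)
    finally show "X_sp F p \<bullet> (p - q) \<le> - (s / 2) * (norm (p - q))\<^sup>2" by simp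
  qed (use s r in auto)
qed

lemma saddle_global_dissipation:
  assumes const: "grad_xz F constant_on UNIV" and sq: "jointly_sqcc_with s UNIV F"
    and q: "q \<in> Saddle F"
  shows "X_sp F p \<bullet> (p - q) \<le> - s * (norm (p - q))\<^sup>2"
proof -
  \<comment> \<open>Lipschitz constant 0 removes the cubic term, and the radius is chosen so that
    the ball contains \<open>p\<close>.\<close>
  have "0-lipschitz_on (ball q (dist q p + 1)) (grad_xz F)"
    using const by (auto simp: constant_on_def intro!: lipschitz_onI)
  from saddle_dissipation[OF q sq _ this, of p] show ?thesis by simp
qed

end

section \<open>From dissipation to stability and convergence\<close>

lemma dissipative_convergence:
  fixes X :: "'a::real_inner \<Rightarrow> 'a"
  assumes "trajectory X \<gamma>" "\<gamma> 0 \<in> ball q r" and "0 < c"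
    and "\<And>p. p \<in> ball q r \<Longrightarrow> X p \<bullet> (p - q) \<le> - c * (norm (p - q))\<^sup>2"
  shows "(\<gamma> \<longlongrightarrow> q) at_top"
proof -
  have lim: "((\<lambda>t. norm (\<gamma> 0 - q) * exp (- c * t)) \<longlongrightarrow> norm (\<gamma> 0 - q) * 0) at_top"
    using \<open>0 < c\<close>
    by (intro tendsto_intros filterlim_compose[OF exp_at_bot]
        filterlim_tendsto_neg_mult_at_bot[OF tendsto_const] filterlim_ident) auto
  have "\<forall>\<^sub>F t in at_top. norm (\<gamma> t - q) \<le> norm (\<gamma> 0 - q) * exp (- c * t)"
    using eventually_ge_at_top[of 0]
    by eventually_elim (use trajectory_decay[OF assms(1,2) less_imp_le[OF assms(3)] assms(4)] in blast)
  then have "((\<lambda>t. \<gamma> t - q) \<longlongrightarrow> 0) at_top"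
    by (rule Lim_null_comparison) (use lim in simp)
  then show ?thesis by (simp add: LIM_zero_iff)
qed

lemma dissipative_stable:
  fixes X :: "'a::real_inner \<Rightarrow> 'a"
  assumes "0 < r" "0 \<le> c"
    and X: "\<And>p. p \<in> ball q r \<Longrightarrow> X p \<bullet> (p - q) \<le> - c * (norm (p - q))\<^sup>2"
  shows "stable_set X {q}"
  unfolding stable_set_def
proof (intro allI impI)
  fix e :: real assume "0 < e"
  show "\<exists>W. open W \<and> {q} \<subseteq> W \<and>
      (\<forall>\<gamma>. trajectory X \<gamma> \<and> \<gamma> 0 \<in> W \<longrightarrow> (\<forall>t\<ge>0. infdist (\<gamma> t) {q} < e))"
  \<comment> \<open>Radius at most \<open>r\<close> makes the dissipation available; as the distance
    to \<open>q\<close> never exceeds its initial value, radius at most \<open>e\<close> suffices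
    for the bound.\<close>
  proof (intro exI[of _ "ball q (min r e)"] conjI allI impI)
    fix \<gamma> and t :: real
    assume \<gamma>: "trajectory X \<gamma> \<and> \<gamma> 0 \<in> ball q (min r e)" and "0 \<le> t"
    then have "norm (\<gamma> t - q) \<le> norm (\<gamma> 0 - q) * exp (- c * t)"
      using \<open>0 \<le> c\<close> X by (intro trajectory_decay[where r = r]) auto
    also have "\<dots> \<le> norm (\<gamma> 0 - q) * 1"
      using \<open>0 \<le> c\<close> \<open>0 \<le> t\<close> by (intro mult_left_mono) auto
    finally show "infdist (\<gamma> t) {q} < e" using \<gamma> by (simp add: dist_norm norm_minus_commute)
  qed (use \<open>0 < r\<close> \<open>0 < e\<close> in auto)
qed

lemma pointwise_convergence_imp_attracted:
  assumes "pointwise_convergence_from X W S"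
  shows "attracted_from X W S"
  unfolding attracted_from_def
proof (intro allI impI)
  fix \<gamma> assume "trajectory X \<gamma> \<and> \<gamma> 0 \<in> W"
  then obtain p where "p \<in> S" and lim: "(\<gamma> \<longlongrightarrow> p) at_top"
    using assms unfolding pointwise_convergence_from_def by blast
  from tendsto_infdist[OF lim, of S] \<open>p \<in> S\<close>
  show "((\<lambda>t. infdist (\<gamma> t) S) \<longlongrightarrow> 0) at_top" by simp
qed

section \<open>Asymptotic stability of isolated components and of the whole saddle set\<close>

theorem proposition4p8:
  fixes F :: "(real^'n) \<times> (real^'m) \<Rightarrow> real"
  assumes "C2_fun F"
    and "Saddle F \<noteq> {}"
    and "locally_lipschitz (grad_xz F)"
    and "locally_jointly_sqcc_on (Saddle F) F"
  shows "(\<forall>S. isolated_path_component S (Saddle F) \<longrightarrow>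
            locally_asymptotically_stable (X_sp F) S \<and>
            local_convergence_to_point (X_sp F) S) \<and>
         (globally_jointly_sqcc F \<and> grad_xz F constant_on UNIV \<longrightarrow>
            globally_asymptotically_stable (X_sp F) (Saddle F) \<and>
            global_convergence_to_point (X_sp F) (Saddle F))"
proof -
  obtain F' F'' where D: "\<And>p. (F has_derivative blinfun_apply (F' p)) (at p)"
    "\<And>p. (F' has_derivative blinfun_apply (F'' p)) (at p)" "continuous_on UNIV F''"
    using assms(1) unfolding C2_fun_def C1_fun_def by blast
  have eq: "X_sp F p = 0" if "p \<in> Saddle F" for p using Saddle_equilibrium[OF D that] .
  have "locally_asymptotically_stable (X_sp F) S \<and> local_convergence_to_point (X_sp F) S"
    if S: "isolated_path_component S (Saddle F)" for S
  \<comment> \<open>The empty set also counts as an isolated path connected component; it is its own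
    open neighborhood, from which no trajectory starts.\<close>
  proof (cases "S = {}")
    case True
    have "pointwise_convergence_from (X_sp F) {} S" by (simp add: pointwise_convergence_from_def)
    then show ?thesis
      using pointwise_convergence_imp_attracted[of "X_sp F" "{}" S] True
      by (auto simp: locally_asymptotically_stable_def local_convergence_to_point_def stable_set_def
          intro: exI[of _ "{}"])
  next
    case False
    then obtain q where "q \<in> S" by blast
    have sub: "S \<subseteq> Saddle F" and "path_connected S"
      using S by (auto simp: isolated_path_component_def)
    then have q: "q \<in> Saddle F" using \<open>q \<in> S\<close> by blast
    with assms(4) have "locally_jointly_sqcc_at F q" by (simp add: locally_jointly_sqcc_on_def)
    from saddle_local_dissipation[OF D assms(3) q this] obtain c r where cr: "0 < c" "0 < r"
      "\<And>p. p \<in> ball q r \<Longrightarrow> X_sp F p \<bullet> (p - q) \<le> - c * (norm (p - q))\<^sup>2"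
      by blast
    \<comment> \<open>At an equilibrium the left side of the dissipation inequality is zero, so the
      distance to \<open>q\<close> must vanish.\<close>
    have "p = q" if "p \<in> Saddle F" "p \<in> ball q r" for p
      using cr(3)[OF that(2)] eq[OF that(1)] cr(1) by (simp add: mult_le_0_iff)
    \<comment> \<open>Thus \<open>{q}\<close> is both open and closed in the connected set
      \<open>S\<close>, hence all of it.\<close>
    then have "{q} = S \<inter> ball q r" using sub \<open>q \<in> S\<close> \<open>0 < r\<close> by auto
    then have "openin (top_of_set S) {q}" by (metis open_ball openin_open_Int)
    moreover have "closedin (top_of_set S) {q}" using \<open>q \<in> S\<close> by (intro closed_subset) auto
    ultimately have Sq: "S = {q}"
      using path_connected_imp_connected[OF \<open>path_connected S\<close>] unfolding connected_clopen by blast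
    have conv: "pointwise_convergence_from (X_sp F) (ball q r) S"
      unfolding pointwise_convergence_from_def Sq
      using dissipative_convergence[OF _ _ cr(1,3)] by blast
    have "open (ball q r)" "S \<subseteq> ball q r" using Sq \<open>0 < r\<close> by auto
    moreover have "stable_set (X_sp F) S"
      unfolding Sq using cr by (intro dissipative_stable[where r = r and c = c]) auto
    ultimately show ?thesis
      using conv pointwise_convergence_imp_attracted[OF conv] eq sub
      unfolding locally_asymptotically_stable_def local_convergence_to_point_def by blast
  qed
  moreover have "globally_asymptotically_stable (X_sp F) (Saddle F) \<and>
      global_convergence_to_point (X_sp F) (Saddle F)"
    if glob: "globally_jointly_sqcc F" and const: "grad_xz F constant_on UNIV"
  proof -
    obtain s where s: "0 < s" "jointly_sqcc_with s UNIV F"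
      using glob unfolding globally_jointly_sqcc_def by blast
    obtain q where q: "q \<in> Saddle F" using assms(2) by blast
    note X = saddle_global_dissipation[OF D const s(2) q]
    have "p = q" if "p \<in> Saddle F" for p
      using X[of p] eq[OF that] s(1) by (simp add: mult_le_0_iff)
    then have Sq: "Saddle F = {q}" using q by blast
    \<comment> \<open>The dissipation holds everywhere, so any ball containing the initial point
      will do.\<close>
    have "(\<gamma> \<longlongrightarrow> q) at_top" if "trajectory (X_sp F) \<gamma>" for \<gamma>
      using dissipative_convergence[OF that _ s(1) X, of "dist q (\<gamma> 0) + 1"] by simp
    then have conv: "pointwise_convergence_from (X_sp F) UNIV (Saddle F)"
      unfolding pointwise_convergence_from_def Sq by blast
    moreover have "stable_set (X_sp F) (Saddle F)"
      unfolding Sq using s(1) X by (intro dissipative_stable[where r = 1 and c = s]) auto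
    ultimately show ?thesis
      using pointwise_convergence_imp_attracted[OF conv] eq
      unfolding globally_asymptotically_stable_def global_convergence_to_point_def by blast
  qed
  ultimately show ?thesis by blast
qed

end
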